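(* For each integer $n\ge 1$ let $m(n)$ denote the minimum of $M(\mathcal{G})$ over all connected graphs $\mathcal{G}$ with $n$ vertices. Then for each integer $n\ge 1$ $$m(n)=\left\lfloor\frac{(n+1)^2}{4}\right\rfloor=\left\lfloor\frac{n+1}{2}\right\rfloor\cdot\left\lceil\frac{n+1}{2}\right\rceil.$$
   Context: Graphs are finite, simple and undirected. For a graph $\mathcal{G}$ with $n$ vertices and adjacency matrix $A$, viewed over $\mathbb{F}_2$, let $C(\mathcal{G})\subseteq\mathbb{F}_2^{2n}$ be the binary linear code generated by the rows of $[I_n|A]$, where $I_n$ is the $n\times n$ identity matrix. The support of a vector is the set of positions of its nonzero entries. A nonzero codeword $c$ of a binary linear code $C$ is minimal if there is no nonzero codeword $c'\in C$ with $\operatorname{supp}(c')\subsetneq\operatorname{supp}(c)$. $M(\mathcal{G})$ denotes the number of minimal codewords of $C(\mathcal{G})$; it does not depend on the labeling of the vertices. *)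

theory Defs
  imports
    "HOL-Library.Z2"
    "Graph_Theory.Graph_Theory"
    "Jordan_Normal_Form.VS_Connect"
begin

text \<open>
  A finite simple undirected graph is a \<^locale>\<open>pair_graph\<close>: its edge \<open>{u, v}\<close> is the pair of
  arcs \<open>(u, v)\<close> and \<open>(v, u)\<close>. Graphs with \<open>n\<close> vertices are taken on the vertex set
  \<open>{0..<n}\<close>, which fixes the order of the rows and columns of the adjacency matrix; up to
  relabeling these are all graphs with \<open>n\<close> vertices.
\<close>

definition connected_graphs :: "nat \<Rightarrow> nat pair_pre_digraph set" where
  "connected_graphs n = {G. pair_graph G \<and> pverts G = {0..<n} \<and> connected (with_proj G)}"

definition adjacency_mat :: "nat pair_pre_digraph \<Rightarrow> bit mat" where
  "adjacency_mat G =
     (let n = card (pverts G) in mat n n (\<lambda>(i, j). if (i, j) \<in> parcs G then 1 else 0))"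

text \<open>
  The library has no juxtaposition of matrices side by side, so \<open>[I\<^sub>n|A]\<close> is a block matrix
  whose lower blocks have no rows.
\<close>

definition generator_mat :: "nat pair_pre_digraph \<Rightarrow> bit mat" where
  "generator_mat G =
     (let n = card (pverts G)
      in four_block_mat (1\<^sub>m n) (adjacency_mat G) (0\<^sub>m 0 n) (0\<^sub>m 0 n))"

definition graph_code :: "nat pair_pre_digraph \<Rightarrow> bit vec set" where
  "graph_code G = vec_space.row_space (2 * card (pverts G)) (generator_mat G)"

definition supp_vec :: "bit vec \<Rightarrow> nat set" where
  "supp_vec c = {i. i < dim_vec c \<and> c $ i \<noteq> 0}"

definition minimal_codeword :: "bit vec set \<Rightarrow> bit vec \<Rightarrow> bool" where
  "minimal_codeword C c \<longleftrightarrow>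
     c \<in> C \<and> c \<noteq> 0\<^sub>v (dim_vec c) \<and>
     \<not> (\<exists>c'\<in>C. c' \<noteq> 0\<^sub>v (dim_vec c') \<and> supp_vec c' \<subset> supp_vec c)"

definition num_minimal_codewords :: "nat pair_pre_digraph \<Rightarrow> nat" where
  "num_minimal_codewords G = card {c. minimal_codeword (graph_code G) c}"

text \<open>
  The set below is finite because a code of a graph with \<open>n\<close> vertices has at most \<open>2 ^ n\<close>
  codewords, and it is nonempty for \<open>n \<ge> 1\<close>.
\<close>

definition min_num_minimal_codewords :: "nat \<Rightarrow> nat" where
  "min_num_minimal_codewords n = Min (num_minimal_codewords ` connected_graphs n)"

end

theory Submission
  imports Defs
begin

text \<open>
  A set \<open>S\<close> of vertices corresponds to the codeword that is the sum of the rows indexed by \<open>S\<close>; its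
  support is \<open>S\<close> in the left half and, in the right half, the set of vertices with an odd number of
  neighbours in \<open>S\<close>. So minimality of a codeword is a property of a nonempty vertex set \<open>S\<close>: no
  nonempty proper subset \<open>T\<close> of \<open>S\<close> satisfies \<open>odd_nbrs E T \<subseteq> odd_nbrs E S\<close>.

  Lower bound. Relate two vertices when they have a common neighbour. The vertex set of a shortest
  path of this relation is minimal (\<open>minimal_geodesic\<close>), and it determines the ends of the path
  (\<open>geodesic_ends_unique\<close>). Hence there are at least as many minimal codewords as there are sets
  \<open>{i, j}\<close>, with \<open>i = j\<close> admitted, of vertices joined by such a path. In a connected graph the
  vertices split into at most two parts, of sizes \<open>a\<close> and \<open>b\<close>, within which any two vertices are
  joined by a walk of even length (\<open>two_classes\<close>). This yields \<open>a(a+1)/2 + b(b+1)/2\<close> minimal codewords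
  with \<open>a + b = n\<close>, which is at least \<open>\<lfloor>(n+1)\<^sup>2/4\<rfloor>\<close>.

  Upper bound. In the double star with two adjacent centres and balanced leaves, a minimal set lies in
  one colour class, because the two classes have disjoint neighbourhoods. It has at most two
  elements, because two leaves at the same centre already form a codeword with empty right half.
  Counting the sets of at most two vertices in one colour class gives the same number.
\<close>

section \<open>Codewords as vertex sets\<close>

text \<open>The vertices with an odd number of neighbours in \<open>S\<close>, for a finite set \<open>S\<close>.\<close>

definition odd_nbrs :: "('a \<times> 'a) set \<Rightarrow> 'a set \<Rightarrow> 'a set" where
  "odd_nbrs E S = {v. odd (card {u \<in> S. (u, v) \<in> E})}"

text \<open>
  Minimality of the codeword of \<open>S\<close>, expressed in terms of vertex sets: a codeword whose support is
  contained in that of \<open>S\<close> comes from a subset \<open>T\<close> of \<open>S\<close> with \<open>odd_nbrs E T \<subseteq> odd_nbrs E S\<close>.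
\<close>

definition minimal_vertex_set :: "('a \<times> 'a) set \<Rightarrow> 'a set \<Rightarrow> bool" where
  "minimal_vertex_set E S \<longleftrightarrow>
     S \<noteq> {} \<and> (\<forall>T. T \<subseteq> S \<longrightarrow> T \<noteq> {} \<longrightarrow> odd_nbrs E T \<subseteq> odd_nbrs E S \<longrightarrow> T = S)"

text \<open>
  The sum of the rows of \<open>[I|A]\<close> indexed by \<open>S\<close>: the indicator vector of \<open>S\<close> followed by the
  indicator vector of \<open>odd_nbrs E S\<close>.
\<close>

definition codeword :: "nat \<Rightarrow> (nat \<times> nat) set \<Rightarrow> nat set \<Rightarrow> bit vec" where
  "codeword n E S =
     vec (2 * n) (\<lambda>k. of_bool (if k < n then k \<in> S else k - n \<in> odd_nbrs E S))"

lemma sum_of_bool_bit_eq: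
  assumes "finite F"
  shows "(\<Sum>i\<in>F. of_bool (P i) :: bit) = of_bool (odd (card {i \<in> F. P i}))"
  using assms
proof (induction F)
  case empty
  then show ?case by simp
next
  case (insert x F)
  have "{i \<in> insert x F. P i} = (if P x then insert x {i \<in> F. P i} else {i \<in> F. P i})"
    by auto
  then show ?case
    using insert by simp
qed

lemma generator_mat_carrier:
  assumes "card (pverts G) = n"
  shows "generator_mat G \<in> carrier_mat n (2 * n)"
  unfolding generator_mat_def Let_def assms
  using four_block_carrier_mat[of "1\<^sub>m n" n n "0\<^sub>m 0 n" 0 n "adjacency_mat G" "0\<^sub>m 0 n"]
  by (simp add: mult_2)

lemma generator_mat_transpose_mult:
  assumes n: "card (pverts G) = n" and S: "S \<subseteq> {0..<n}"
  shows "(generator_mat G)\<^sup>T *\<^sub>v vec n (\<lambda>i. of_bool (i \<in> S)) = codeword n (parcs G) S"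
proof (rule eq_vecI)
  show "dim_vec ((generator_mat G)\<^sup>T *\<^sub>v vec n (\<lambda>i. of_bool (i \<in> S)))
    = dim_vec (codeword n (parcs G) S)"
    using generator_mat_carrier[OF n] by (simp add: codeword_def)
next
  fix k assume "k < dim_vec (codeword n (parcs G) S)"
  then have k: "k < 2 * n" by (simp add: codeword_def)
  have "((generator_mat G)\<^sup>T *\<^sub>v vec n (\<lambda>i. of_bool (i \<in> S))) $ k
    = (\<Sum>i\<in>{0..<n}. generator_mat G $$ (i, k) * of_bool (i \<in> S))"
    using generator_mat_carrier[OF n] k by (simp add: scalar_prod_def)
  also have "\<dots> = (\<Sum>i\<in>{0..<n}. of_bool (i \<in> S \<and> (if k < n then i = k else (i, k - n) \<in> parcs G)))"
    using n k by (intro sum.cong refl) (auto simp: generator_mat_def adjacency_mat_def Let_def)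
  also have "\<dots> = of_bool (odd (card {i \<in> {0..<n}. i \<in> S \<and> (if k < n then i = k else (i, k - n) \<in> parcs G)}))"
    by (rule sum_of_bool_bit_eq) simp
  also have "\<dots> = codeword n (parcs G) S $ k"
  proof (cases "k < n")
    case True
    then have "{i \<in> {0..<n}. i \<in> S \<and> (if k < n then i = k else (i, k - n) \<in> parcs G)}
      = (if k \<in> S then {k} else {})" by auto
    then show ?thesis using True by (simp add: codeword_def)
  next
    case False
    then have eq: "{i \<in> {0..<n}. i \<in> S \<and> (if k < n then i = k else (i, k - n) \<in> parcs G)}
      = {u \<in> S. (u, k - n) \<in> parcs G}" using S by auto
    show ?thesis
      unfolding eq using False k by (simp add: codeword_def odd_nbrs_def)
  qed
  finally show "((generator_mat G)\<^sup>T *\<^sub>v vec n (\<lambda>i. of_bool (i \<in> S))) $ k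
    = codeword n (parcs G) S $ k" .
qed

lemma graph_code_eq:
  assumes n: "card (pverts G) = n"
  shows "graph_code G = codeword n (parcs G) ` Pow {0..<n}"
proof -
  interpret vec_space "TYPE(bit)" "2 * n" .
  note A = generator_mat_carrier[OF n]
  have ind: "\<exists>S\<subseteq>{0..<n}. y = vec n (\<lambda>i. of_bool (i \<in> S))" if "y \<in> carrier_vec n" for y :: "bit vec"
  proof (intro exI conjI)
    show "{i. i < n \<and> y $ i = 1} \<subseteq> {0..<n}" by auto
    show "y = vec n (\<lambda>i. of_bool (i \<in> {i. i < n \<and> y $ i = 1}))"
      using that by (intro eq_vecI) auto
  qed
  have "graph_code G = {w \<in> carrier_vec (2 * n). \<exists>y\<in>carrier_vec n. (generator_mat G)\<^sup>T *\<^sub>v y = w}"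
    unfolding graph_code_def n using row_space_eq[OF A] A by simp
  also have "\<dots> = codeword n (parcs G) ` Pow {0..<n}"
  proof (intro equalityI subsetI)
    fix w assume "w \<in> {w \<in> carrier_vec (2 * n). \<exists>y\<in>carrier_vec n. (generator_mat G)\<^sup>T *\<^sub>v y = w}"
    then obtain y where y: "y \<in> carrier_vec n" "(generator_mat G)\<^sup>T *\<^sub>v y = w" by auto
    from ind[OF y(1)] obtain S where "S \<subseteq> {0..<n}" "y = vec n (\<lambda>i. of_bool (i \<in> S))" by auto
    then show "w \<in> codeword n (parcs G) ` Pow {0..<n}"
      using y(2) generator_mat_transpose_mult[OF n] by auto
  next
    fix w assume "w \<in> codeword n (parcs G) ` Pow {0..<n}"
    then obtain S where S: "S \<subseteq> {0..<n}" "w = codeword n (parcs G) S" by auto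
    have "vec n (\<lambda>i. of_bool (i \<in> S)) \<in> carrier_vec n" by simp
    with generator_mat_transpose_mult[OF n S(1)] S(2)
    show "w \<in> {w \<in> carrier_vec (2 * n). \<exists>y\<in>carrier_vec n. (generator_mat G)\<^sup>T *\<^sub>v y = w}"
      by (auto simp: codeword_def)
  qed
  finally show ?thesis .
qed

lemma supp_codeword:
  assumes "S \<subseteq> {0..<n}" "E \<subseteq> {0..<n} \<times> {0..<n}"
  shows "supp_vec (codeword n E S) = S \<union> (+) n ` odd_nbrs E S"
proof -
  have "odd_nbrs E S \<subseteq> {0..<n}"
  proof
    fix v assume "v \<in> odd_nbrs E S"
    then have "{u \<in> S. (u, v) \<in> E} \<noteq> {}"
      unfolding odd_nbrs_def by (metis (no_types, lifting) card.empty even_zero mem_Collect_eq)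
    then show "v \<in> {0..<n}" using assms(2) by auto
  qed
  moreover have "k \<in> supp_vec (codeword n E S) \<longleftrightarrow>
      k < 2 * n \<and> (if k < n then k \<in> S else k - n \<in> odd_nbrs E S)" for k
    by (auto simp: supp_vec_def codeword_def)
  moreover have "k \<in> (+) n ` odd_nbrs E S \<longleftrightarrow> n \<le> k \<and> k - n \<in> odd_nbrs E S" for k
    by (force simp: image_iff)
  ultimately show ?thesis
    using assms(1) by (auto simp: set_eq_iff subset_iff)
qed

lemma num_minimal_codewords_eq:
  assumes G: "pverts G = {0..<n}" "parcs G \<subseteq> {0..<n} \<times> {0..<n}"
  shows "num_minimal_codewords G = card {S. S \<subseteq> {0..<n} \<and> minimal_vertex_set (parcs G) S}"
proof -
  let ?c = "codeword n (parcs G)"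
  have code: "graph_code G = ?c ` Pow {0..<n}"
    by (rule graph_code_eq) (simp add: G)
  have supp: "supp_vec (?c S) = S \<union> (+) n ` odd_nbrs (parcs G) S" if "S \<subseteq> {0..<n}" for S
    using supp_codeword that G by blast
  have psub: "supp_vec (?c T) \<subset> supp_vec (?c S) \<longleftrightarrow>
      T \<subset> S \<and> odd_nbrs (parcs G) T \<subseteq> odd_nbrs (parcs G) S"
    if S: "S \<subseteq> {0..<n}" and T: "T \<subseteq> {0..<n}" for S T
  proof -
    have sub: "supp_vec (?c T) \<subseteq> supp_vec (?c S) \<longleftrightarrow>
      T \<subseteq> S \<and> odd_nbrs (parcs G) T \<subseteq> odd_nbrs (parcs G) S" 
      if "S \<subseteq> {0..<n}" "T \<subseteq> {0..<n}" for S T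
      using that by (force simp: supp)
    show ?thesis
      using sub[OF S T] sub[OF T S] by auto
  qed
  have zero: "?c S = 0\<^sub>v (dim_vec (?c S)) \<longleftrightarrow> S = {}" if "S \<subseteq> {0..<n}" for S
  proof
    assume zero: "?c S = 0\<^sub>v (dim_vec (?c S))"
    have "supp_vec (?c S) = {}"
      by (subst zero) (simp add: supp_vec_def)
    then show "S = {}" using supp[OF that] by auto
  next
    assume "S = {}"
    then show "?c S = 0\<^sub>v (dim_vec (?c S))"
      by (intro eq_vecI) (auto simp: codeword_def odd_nbrs_def)
  qed
  have inj: "inj_on ?c (Pow {0..<n})"
  proof (rule inj_onI)
    fix S T assume ST: "S \<in> Pow {0..<n}" "T \<in> Pow {0..<n}" "?c S = ?c T"
    then have eq: "S \<union> (+) n ` odd_nbrs (parcs G) S = T \<union> (+) n ` odd_nbrs (parcs G) T"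
      using supp[of S] supp[of T] by simp
    have "S = (S \<union> (+) n ` odd_nbrs (parcs G) S) \<inter> {0..<n}"
      using ST(1) by auto
    also have "\<dots> = (T \<union> (+) n ` odd_nbrs (parcs G) T) \<inter> {0..<n}"
      by (simp only: eq)
    also have "\<dots> = T"
      using ST(2) by auto
    finally show "S = T" .
  qed
  have char: "minimal_codeword (graph_code G) (?c S) \<longleftrightarrow> minimal_vertex_set (parcs G) S"
    if S: "S \<subseteq> {0..<n}" for S
  proof -
    have "minimal_codeword (graph_code G) (?c S) \<longleftrightarrow>
        S \<noteq> {} \<and> \<not> (\<exists>T\<in>Pow {0..<n}. T \<noteq> {} \<and> supp_vec (?c T) \<subset> supp_vec (?c S))"
      unfolding minimal_codeword_def code using S by (simp add: zero Bex_def cong: conj_cong)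
    also have "\<dots> \<longleftrightarrow> S \<noteq> {} \<and>
        \<not> (\<exists>T\<subseteq>{0..<n}. T \<noteq> {} \<and> T \<subset> S \<and> odd_nbrs (parcs G) T \<subseteq> odd_nbrs (parcs G) S)"
      using psub[OF S] by (simp add: Bex_def cong: conj_cong)
    also have "\<dots> \<longleftrightarrow> minimal_vertex_set (parcs G) S"
      unfolding minimal_vertex_set_def using S by blast
    finally show ?thesis .
  qed
  have "{c. minimal_codeword (graph_code G) c} = ?c ` {S. S \<subseteq> {0..<n} \<and> minimal_vertex_set (parcs G) S}"
    (is "?L = ?c ` ?R")
  proof (intro equalityI subsetI)
    fix c assume c: "c \<in> ?L"
    then obtain S where "S \<subseteq> {0..<n}" "c = ?c S"
      using code by (auto simp: minimal_codeword_def)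
    then show "c \<in> ?c ` ?R" using c char by blast
  next
    fix c assume "c \<in> ?c ` ?R"
    then show "c \<in> ?L" using char by blast
  qed
  moreover have "inj_on ?c ?R"
    by (rule inj_on_subset[OF inj]) auto
  ultimately show ?thesis
    unfolding num_minimal_codewords_def by (simp add: card_image)
qed

section \<open>Geodesics are minimal vertex sets\<close>

text \<open>
  \<open>f 0, \<dots>, f m\<close> is a shortest \<open>R\<close>-path: consecutive vertices are related, and two vertices whose
  indices differ by \<open>d\<close> are not joined by fewer than \<open>d\<close> steps. The inequality is stated without
  truncated subtraction and is vacuous when \<open>b \<le> a\<close>; for symmetric \<open>R\<close> this is no loss.
\<close>

definition geodesic :: "('a \<times> 'a) set \<Rightarrow> (nat \<Rightarrow> 'a) \<Rightarrow> nat \<Rightarrow> bool" where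
  "geodesic R f m \<longleftrightarrow>
     (\<forall>a<m. (f a, f (Suc a)) \<in> R) \<and>
     (\<forall>a\<le>m. \<forall>b\<le>m. \<forall>k. (f a, f b) \<in> R ^^ k \<longrightarrow> b \<le> a + k)"

lemma relpow_path:
  assumes "\<forall>a<m. (f a, f (Suc a)) \<in> R" "a \<le> b" "b \<le> m"
  shows "(f a, f b) \<in> R ^^ (b - a)"
  unfolding relpow_fun_conv using assms by (intro exI[of _ "\<lambda>i. f (a + i)"]) auto

lemma sym_relpow:
  assumes "sym R"
  shows "sym (R ^^ k)"
proof (induction k)
  case 0
  then show ?case by (simp add: sym_Id)
next
  case (Suc k)
  have "(y, x) \<in> R ^^ Suc k" if xy: "(x, y) \<in> R ^^ Suc k" for x y
  proof -
    obtain z where "(x, z) \<in> R ^^ k" "(z, y) \<in> R" using xy by (rule relpow_Suc_E)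
    then have "(y, z) \<in> R" "(z, x) \<in> R ^^ k" using Suc assms by (auto dest: symD)
    then show ?thesis by (rule relpow_Suc_I2)
  qed
  then show ?case by (auto intro!: symI simp del: relpow.simps)
qed

lemma geodesic_exists:
  assumes "(i, j) \<in> R\<^sup>*"
  obtains f m where "geodesic R f m" "f 0 = i" "f m = j"
proof -
  define m where "m = (LEAST k. (i, j) \<in> R ^^ k)"
  have m: "(i, j) \<in> R ^^ m"
    unfolding m_def using assms rtrancl_imp_relpow by (metis LeastI)
  then obtain f where f: "f 0 = i" "f m = j" "\<forall>a<m. (f a, f (Suc a)) \<in> R"
    by (auto simp: relpow_fun_conv)
  have "b \<le> a + k" if "a \<le> m" "b \<le> m" "(f a, f b) \<in> R ^^ k" for a b k
  proof -
    have "(i, f a) \<in> R ^^ a" "(f b, j) \<in> R ^^ (m - b)"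
      using relpow_path[OF f(3), of 0 a] relpow_path[OF f(3), of b m] that f by auto
    then have "(i, j) \<in> R ^^ (a + k + (m - b))"
      using that(3) by (auto simp: relpow_add)
    then have "m \<le> a + k + (m - b)"
      unfolding m_def by (rule Least_le)
    then show ?thesis using that(2) by linarith
  qed
  then show ?thesis using that f unfolding geodesic_def by blast
qed

lemma geodesic_inj_on:
  assumes "geodesic R f m"
  shows "inj_on f {..m}"
proof (rule inj_onI)
  fix a b assume "a \<in> {..m}" "b \<in> {..m}" "f a = f b"
  then have "(f a, f b) \<in> R ^^ 0" "(f b, f a) \<in> R ^^ 0" by auto
  then have "b \<le> a + 0" "a \<le> b + 0"
    using assms \<open>a \<in> {..m}\<close> \<open>b \<in> {..m}\<close> unfolding geodesic_def by blast+
  then show "a = b" by simp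
qed

text \<open>
  The vertex set of a geodesic determines its length \<open>m\<close>, and its ends are the only two of its
  vertices that are at distance \<open>m\<close>.
\<close>

lemma geodesic_ends_unique:
  assumes f: "geodesic R f m" and g: "geodesic R g l"
    and eq: "f ` {..m} = g ` {..l}" and "sym R"
  shows "{f 0, f m} = {g 0, g l}"
proof -
  have "card (f ` {..m}) = Suc m" "card (g ` {..l}) = Suc l"
    using geodesic_inj_on[OF f] geodesic_inj_on[OF g] by (simp_all add: card_image)
  then have lm: "l = m" using eq by simp
  have "g 0 \<in> f ` {..m}" "g m \<in> f ` {..m}"
    unfolding eq lm by auto
  then obtain a b where ab: "a \<le> m" "b \<le> m" "g 0 = f a" "g m = f b"
    by blast
  have fR: "\<forall>a<m. (f a, f (Suc a)) \<in> R" using f by (auto simp: geodesic_def)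
  have "m \<le> b - a + (a - b)"
  proof (cases "a \<le> b")
    case True
    then have "(g 0, g m) \<in> R ^^ (b - a)"
      using relpow_path[OF fR] ab by simp
    then have "m \<le> 0 + (b - a)"
      using g lm unfolding geodesic_def by blast
    then show ?thesis by simp
  next
    case False
    then have "(g m, g 0) \<in> R ^^ (a - b)"
      using relpow_path[OF fR] ab by simp
    then have "(g 0, g m) \<in> R ^^ (a - b)"
      using sym_relpow[OF \<open>sym R\<close>] by (auto dest: symD)
    then have "m \<le> 0 + (a - b)"
      using g lm unfolding geodesic_def by blast
    then show ?thesis by simp
  qed
  then have "a = 0 \<and> b = m \<or> a = m \<and> b = 0"
    using ab by linarith
  then show ?thesis using ab lm by auto
qed

text \<open>
  The vertices related by \<open>E O E\<close> are those with a common neighbour. If \<open>T\<close> is a nonempty proper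
  subset of a geodesic of this relation, some consecutive pair has exactly one vertex in \<open>T\<close>. A
  common neighbour \<open>x\<close> of the pair has no third neighbour on the geodesic, hence it has one neighbour
  in \<open>T\<close> but two on the geodesic, so that \<open>T\<close> gives no codeword of smaller support.
\<close>

lemma minimal_geodesic:
  assumes "sym E" and f: "geodesic (E O E) f m"
  shows "minimal_vertex_set E (f ` {..m})"
proof -
  have "T = f ` {..m}"
    if T: "T \<subseteq> f ` {..m}" "T \<noteq> {}" and sub: "odd_nbrs E T \<subseteq> odd_nbrs E (f ` {..m})" for T
  proof (rule ccontr)
    assume "T \<noteq> f ` {..m}"
    have "\<exists>a<m. (f a \<in> T) \<noteq> (f (Suc a) \<in> T)"
    proof (rule ccontr)
      assume *: "\<not> (\<exists>a<m. (f a \<in> T) \<noteq> (f (Suc a) \<in> T))"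
      have "f a \<in> T \<longleftrightarrow> f 0 \<in> T" if "a \<le> m" for a
        using that by (induction a) (use * in auto)
      then show False using T \<open>T \<noteq> f ` {..m}\<close> by blast
    qed
    then obtain a where a: "a < m" "(f a \<in> T) \<noteq> (f (Suc a) \<in> T)" by blast
    have "(f a, f (Suc a)) \<in> E O E" using f a(1) by (auto simp: geodesic_def)
    then obtain x where x: "(f a, x) \<in> E" "(x, f (Suc a)) \<in> E" by auto
    have x': "(f (Suc a), x) \<in> E" using x \<open>sym E\<close> by (auto dest: symD)
    \<comment> \<open>a third neighbour of \<open>x\<close> on the geodesic would be a shortcut\<close>
    have only: "u \<in> {f a, f (Suc a)}" if u: "u \<in> f ` {..m}" "(u, x) \<in> E" for u
    proof -
      obtain b where b: "b \<le> m" "u = f b" using u by auto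
      have "(x, f b) \<in> E" "(x, f a) \<in> E" using u(2) b x(1) \<open>sym E\<close> by (auto dest: symD)
      then have "(f a, f b) \<in> (E O E) ^^ 1" "(f b, f (Suc a)) \<in> (E O E) ^^ 1"
        using u(2) b x by auto
      then have "b \<le> a + 1" "Suc a \<le> b + 1"
        using f a(1) b(1) unfolding geodesic_def by (meson Suc_leI less_imp_le)+
      then have "b = a \<or> b = Suc a" by linarith
      then show ?thesis using b by auto
    qed
    have "f a \<noteq> f (Suc a)" using a(2) by metis
    then have "card {u \<in> f ` {..m}. (u, x) \<in> E} = 2"
    proof -
      have "{u \<in> f ` {..m}. (u, x) \<in> E} = {f a, f (Suc a)}"
        using only x x' a(1) by auto
      then show ?thesis using \<open>f a \<noteq> f (Suc a)\<close> by simp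
    qed
    then have "x \<notin> odd_nbrs E (f ` {..m})" by (simp add: odd_nbrs_def)
    moreover have "{u \<in> T. (u, x) \<in> E} = {f a} \<or> {u \<in> T. (u, x) \<in> E} = {f (Suc a)}"
    proof -
      have "{u \<in> T. (u, x) \<in> E} \<subseteq> {f a, f (Suc a)}" using only T(1) by blast
      then show ?thesis using x(1) x' a(2) by blast
    qed
    then have "x \<in> odd_nbrs E T" by (auto simp: odd_nbrs_def)
    ultimately show False using sub by blast
  qed
  then show ?thesis by (auto simp: minimal_vertex_set_def)
qed

section \<open>The lower bound\<close>

text \<open>
  If \<open>uv\<close> is an edge, every vertex is joined by a walk of even length to \<open>u\<close> or to \<open>v\<close>. The set \<open>A\<close>
  is the class of \<open>u\<close>; its complement is empty when an odd closed walk exists. If there is no edge,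
  then \<open>V\<close> has at most one vertex and \<open>A = V\<close>.
\<close>

lemma two_classes:
  assumes "sym E" and conn: "\<And>u v. u \<in> V \<Longrightarrow> v \<in> V \<Longrightarrow> (u, v) \<in> E\<^sup>*" and "E \<subseteq> V \<times> V"
  obtains A where "A \<subseteq> V"
    "\<And>i j. i \<in> A \<Longrightarrow> j \<in> A \<Longrightarrow> (i, j) \<in> (E O E)\<^sup>*"
    "\<And>i j. i \<in> V - A \<Longrightarrow> j \<in> V - A \<Longrightarrow> (i, j) \<in> (E O E)\<^sup>*"
proof (cases "E = {}")
  case True
  then show ?thesis using conn that[of V] by auto
next
  case False
  then obtain u v where uv: "(u, v) \<in> E" "u \<in> V" "v \<in> V" using assms(3) by auto
  have vu: "(v, u) \<in> E" using uv \<open>sym E\<close> by (auto dest: symD)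
  have "sym (E O E)" using \<open>sym E\<close> by (auto simp: sym_def)
  then have sym: "sym ((E O E)\<^sup>*)" by (rule sym_rtrancl)
  have odd_step: "(y, z) \<in> (E O E)\<^sup>*" if "(x, w) \<in> (E O E)\<^sup>*" "(y, x) \<in> E" "(w, z) \<in> E" for x y w z
    using that
  proof (induction arbitrary: z rule: rtrancl_induct)
    case base
    then show ?case by auto
  next
    case (step w w')
    then obtain t where t: "(w, t) \<in> E" "(t, w') \<in> E" by auto
    then have "(y, t) \<in> (E O E)\<^sup>*" using step by blast
    moreover have "(t, z) \<in> E O E" using t step by auto
    ultimately show ?case by (rule rtrancl_into_rtrancl)
  qed
  have cover: "(u, w) \<in> (E O E)\<^sup>* \<or> (v, w) \<in> (E O E)\<^sup>*" if "(u, w) \<in> E\<^sup>*" for w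
    using that
  proof (induction rule: rtrancl_induct)
    case (step w z)
    then show ?case using odd_step vu uv(1) by blast
  qed simp
  have same: "(i, j) \<in> (E O E)\<^sup>*" if "(x, i) \<in> (E O E)\<^sup>*" "(x, j) \<in> (E O E)\<^sup>*" for x i j
    using that sym by (meson rtrancl_trans symD)
  show ?thesis
  proof (rule that[of "{w \<in> V. (u, w) \<in> (E O E)\<^sup>*}"])
    fix i j assume "i \<in> V - {w \<in> V. (u, w) \<in> (E O E)\<^sup>*}" "j \<in> V - {w \<in> V. (u, w) \<in> (E O E)\<^sup>*}"
    then show "(i, j) \<in> (E O E)\<^sup>*"
      using cover conn uv(2) same by blast
  qed (auto intro: same)
qed

lemma card_small_subsets:
  assumes "finite A"
  shows "card {X. X \<subseteq> A \<and> (card X = 1 \<or> card X = 2)} = card A + (card A choose 2)"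
proof -
  have "{X. X \<subseteq> A \<and> (card X = 1 \<or> card X = 2)}
    = {X. X \<subseteq> A \<and> card X = 1} \<union> {X. X \<subseteq> A \<and> card X = 2}" by auto
  moreover have "card \<dots> = card {X. X \<subseteq> A \<and> card X = 1} + card {X. X \<subseteq> A \<and> card X = 2}"
    using assms by (intro card_Un_disjoint) auto
  ultimately show ?thesis using n_subsets[OF assms] by simp
qed

lemma triangular_sum_ge:
  fixes a b :: nat
  shows "(a + b + 1)\<^sup>2 div 4 \<le> (a + (a choose 2)) + (b + (b choose 2))"
proof -
  have tri: "2 * (c + (c choose 2)) = c * (c + 1)" for c :: nat
  proof -
    have "even (c * (c - 1))" by (cases c) auto
    then have "2 * (c choose 2) = c * (c - 1)" by (simp add: choose_two)
    then show ?thesis by (cases c) (auto simp: algebra_simps)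
  qed
  define t where "t = (a + (a choose 2)) + (b + (b choose 2))"
  have "2 * t = a * (a + 1) + b * (b + 1)"
    using tri[of a] tri[of b] by (simp add: t_def)
  moreover have "2 * a * b \<le> a * a + b * b"
    by (cases a b rule: le_cases) (auto simp: le_iff_add algebra_simps)
  ultimately have "(a + b + 1)\<^sup>2 \<le> 4 * t + 1"
    by (simp add: power2_eq_square algebra_simps)
  then have "(a + b + 1)\<^sup>2 div 4 \<le> (4 * t + 1) div 4"
    by (rule div_le_mono)
  then show ?thesis by (simp add: t_def)
qed

lemma minimal_vertex_sets_ge:
  assumes "finite V" "E \<subseteq> V \<times> V" "sym E"
    and conn: "\<And>u v. u \<in> V \<Longrightarrow> v \<in> V \<Longrightarrow> (u, v) \<in> E\<^sup>*"
  shows "(card V + 1)\<^sup>2 div 4 \<le> card {S. S \<subseteq> V \<and> minimal_vertex_set E S}"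
    (is "_ \<le> card ?M")
proof -
  let ?R = "E O E"
  let ?P = "\<lambda>A. {X. X \<subseteq> A \<and> (card X = 1 \<or> card X = 2)}"
  obtain A where A: "A \<subseteq> V"
    "\<And>i j. i \<in> A \<Longrightarrow> j \<in> A \<Longrightarrow> (i, j) \<in> ?R\<^sup>*"
    "\<And>i j. i \<in> V - A \<Longrightarrow> j \<in> V - A \<Longrightarrow> (i, j) \<in> ?R\<^sup>*"
    using two_classes[OF \<open>sym E\<close> conn \<open>E \<subseteq> V \<times> V\<close>] by blast
  define ends where "ends S X \<longleftrightarrow>
    (\<exists>f m. geodesic ?R f m \<and> S = f ` {..m} \<and> X = {f 0, f m})" for S X
  have symR: "sym ?R" using \<open>sym E\<close> by (auto simp: sym_def)
  have path: "\<exists>S. S \<in> ?M \<and> ends S X" if X: "X \<in> ?P A \<union> ?P (V - A)" for X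
  proof -
    obtain i j where ij: "X = {i, j}"
      using X by (auto simp: card_1_singleton_iff card_2_iff)
    then have "(i, j) \<in> ?R\<^sup>*" and V: "i \<in> V" "j \<in> V" using X A by auto
    then obtain f m where f: "geodesic ?R f m" "f 0 = i" "f m = j"
      using geodesic_exists by metis
    have "f a \<in> V" if "a \<le> m" for a
    proof (cases a)
      case 0
      then show ?thesis using f V by simp
    next
      case (Suc b)
      then have "(f b, f a) \<in> ?R" using f(1) that by (auto simp: geodesic_def)
      then show ?thesis using \<open>E \<subseteq> V \<times> V\<close> by auto
    qed
    then have "f ` {..m} \<in> ?M" using minimal_geodesic[OF \<open>sym E\<close> f(1)] by auto
    then show ?thesis using f ij unfolding ends_def by blast
  qed
  have "\<exists>h. \<forall>X \<in> ?P A \<union> ?P (V - A). h X \<in> ?M \<and> ends (h X) X"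
    by (rule bchoice) (rule ballI, rule path)
  then obtain h where h: "\<And>X. X \<in> ?P A \<union> ?P (V - A) \<Longrightarrow> h X \<in> ?M \<and> ends (h X) X"
    by blast
  have "inj_on h (?P A \<union> ?P (V - A))"
  proof (rule inj_onI)
    fix X Y
    assume "X \<in> ?P A \<union> ?P (V - A)" "Y \<in> ?P A \<union> ?P (V - A)" and eq: "h X = h Y"
    then have "ends (h X) X" "ends (h X) Y"
      using h[of X] h[of Y] by simp_all
    then obtain f m g l where "geodesic ?R f m" "h X = f ` {..m}" "X = {f 0, f m}"
        "geodesic ?R g l" "h X = g ` {..l}" "Y = {g 0, g l}"
      unfolding ends_def by blast
    then show "X = Y"
      using geodesic_ends_unique[of ?R f m g l] symR by simp
  qed
  moreover have "h ` (?P A \<union> ?P (V - A)) \<subseteq> ?M"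
    using h by blast
  ultimately have "card (?P A \<union> ?P (V - A)) \<le> card ?M"
    using \<open>finite V\<close> by (intro card_inj_on_le) auto
  moreover have "card (?P A \<union> ?P (V - A)) = card (?P A) + card (?P (V - A))"
  proof (rule card_Un_disjoint)
    have "finite A" using A(1) \<open>finite V\<close> by (rule finite_subset)
    then show "finite (?P A)" by simp
    show "finite (?P (V - A))" using \<open>finite V\<close> by simp
    show "?P A \<inter> ?P (V - A) = {}"
      by (auto simp: card_1_singleton_iff card_2_iff)
  qed
  moreover have "card (?P A) = card A + (card A choose 2)"
    "card (?P (V - A)) = card (V - A) + (card (V - A) choose 2)"
    using A(1) \<open>finite V\<close> by (intro card_small_subsets; auto intro: finite_subset)+
  moreover have "card V = card A + card (V - A)"
    using A(1) \<open>finite V\<close> by (metis card_Diff_subset card_mono finite_subset le_add_diff_inverse)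
  ultimately show ?thesis using triangular_sum_ge[of "card A" "card (V - A)"] by simp
qed

section \<open>The double star\<close>

text \<open>
  The centres \<open>0\<close> and \<open>1\<close> are adjacent, the odd vertices from \<open>3\<close> on are leaves at \<open>0\<close>, and the even
  vertices from \<open>2\<close> on are leaves at \<open>1\<close>. The two colour classes are the even and the odd vertices,
  and their sizes differ by at most one.
\<close>

definition double_star :: "nat \<Rightarrow> (nat \<times> nat) set" where
  "double_star n = {(i, j). i < n \<and> j < n \<and> (i \<le> 1 \<or> j \<le> 1) \<and> odd (i + j)}"

lemma double_star_connected:
  assumes "u < n" "v < n"
  shows "(u, v) \<in> (double_star n)\<^sup>*"
proof -
  have sym: "sym ((double_star n)\<^sup>*)"
    by (rule sym_rtrancl) (auto simp: double_star_def sym_def)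
  have "(0, w) \<in> (double_star n)\<^sup>*" if "w < n" for w
  proof (cases "even w")
    case True
    show ?thesis
    proof (cases "w = 0")
      case False
      then have "(0, 1) \<in> double_star n" "(1, w) \<in> double_star n"
        using True that by (auto simp: double_star_def)
      then show ?thesis by (meson r_into_rtrancl rtrancl_into_rtrancl)
    qed simp
  next
    case False
    then have "(0, w) \<in> double_star n" using that by (auto simp: double_star_def)
    then show ?thesis by blast
  qed
  then show ?thesis using sym assms by (meson rtrancl_trans symD)
qed

lemma minimal_double_star:
  assumes S: "minimal_vertex_set (double_star n) S" and "S \<subseteq> {0..<n}"
  shows "\<exists>i j. S = {i, j} \<and> i \<le> j \<and> j < n \<and> even (i + j)"
proof -
  let ?E = "double_star n"
  have fin: "finite S" using assms(2) by (rule finite_subset) simp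
  have min: "T = S" if "T \<subseteq> S" "T \<noteq> {}" "odd_nbrs ?E T \<subseteq> odd_nbrs ?E S" for T
    using S that by (auto simp: minimal_vertex_set_def)
  \<comment> \<open>the two colour classes of \<open>S\<close> have disjoint neighbourhoods\<close>
  have par: "even (x + y)" if "x \<in> S" "y \<in> S" for x y
  proof -
    define T where "T = {z \<in> S. even (x + z)}"
    have "v \<in> odd_nbrs ?E S" if v: "v \<in> odd_nbrs ?E T" for v
    proof -
      have "{u \<in> T. (u, v) \<in> ?E} \<noteq> {}"
        using v unfolding odd_nbrs_def by (metis (no_types, lifting) card.empty even_zero mem_Collect_eq)
      then have "odd (x + v)" by (auto simp: T_def double_star_def)
      then have "{u \<in> S. (u, v) \<in> ?E} = {u \<in> T. (u, v) \<in> ?E}"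
        by (auto simp: T_def double_star_def)
      then show ?thesis using v by (simp add: odd_nbrs_def)
    qed
    then have "T = S" using that by (intro min) (auto simp: T_def)
    then show ?thesis using that by (auto simp: T_def)
  qed
  \<comment> \<open>two leaves with the same centre form a codeword supported on these leaves\<close>
  have leaves: "S = {x, y}" if xy: "x \<in> S" "y \<in> S" "x \<noteq> y" "x \<ge> 2" "y \<ge> 2" for x y
  proof -
    have "even (x + y)" using xy par by blast
    then have "{u \<in> {x, y}. (u, v) \<in> ?E} = (if (x, v) \<in> ?E then {x, y} else {})" for v
      using xy assms(2) by (auto simp: double_star_def)
    then have "odd_nbrs ?E {x, y} = {}"
      using xy by (simp add: odd_nbrs_def)
    then show ?thesis using xy min[of "{x, y}"] by simp
  qed
  have "card S \<le> 2"
  proof (rule ccontr)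
    assume "\<not> card S \<le> 2"
    moreover have "card (S \<inter> {0, 1}) \<le> 1"
    proof -
      have "\<not> (0 \<in> S \<and> 1 \<in> S)" using par[of 0 1] by auto
      then have "\<exists>c. S \<inter> {0, 1} \<subseteq> {c}" by auto
      then obtain c where "S \<inter> {0, 1} \<subseteq> {c}" ..
      then have "card (S \<inter> {0, 1}) \<le> card {c}" by (intro card_mono) auto
      then show ?thesis by simp
    qed
    moreover have "card S = card (S \<inter> {0, 1}) + card (S - {0, 1})"
      using fin by (metis card_Int_Diff add.commute)
    ultimately have "2 \<le> card (S - {0, 1})" by linarith
    then obtain x y where "x \<in> S - {0, 1}" "y \<in> S - {0, 1}" "x \<noteq> y"
      by (metis (no_types, lifting) card_2_iff insert_subset obtain_subset_with_card_n)
    then have "S = {x, y}" using leaves[of x y] by auto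
    then show False using \<open>\<not> card S \<le> 2\<close> \<open>x \<noteq> y\<close> by simp
  qed
  moreover have "card S \<noteq> 0" using S fin by (auto simp: minimal_vertex_set_def)
  ultimately have "card S = 1 \<or> card S = 2" by linarith
  then obtain i j where ij: "S = {i, j}" "i \<le> j"
    by (metis card_1_singletonE card_2_iff insert_absorb2 insert_commute linear order_refl)
  then have "even (i + j)" "j < n" using par[of i j] assms(2) by auto
  then show ?thesis using ij by blast
qed

text \<open>
  For each larger element \<open>j\<close> there are \<open>j div 2 + 1\<close> choices of the other element \<open>i \<le> j\<close> of the
  same parity, where \<open>i = j\<close> gives the singleton.
\<close>

lemma minimal_vertex_sets_double_star_le:
  "card {S. S \<subseteq> {0..<n} \<and> minimal_vertex_set (double_star n) S} \<le> (n + 1)\<^sup>2 div 4"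
proof -
  let ?I = "\<lambda>j. {i. i \<le> j \<and> even (i + j)}"
  have "{S. S \<subseteq> {0..<n} \<and> minimal_vertex_set (double_star n) S}
      \<subseteq> (\<Union>j<n. (\<lambda>i. {i, j}) ` ?I j)"
    using minimal_double_star by fastforce
  then have "card {S. S \<subseteq> {0..<n} \<and> minimal_vertex_set (double_star n) S}
      \<le> card (\<Union>j<n. (\<lambda>i. {i, j}) ` ?I j)"
    by (intro card_mono) auto
  also have "\<dots> \<le> (\<Sum>j<n. card ((\<lambda>i. {i, j}) ` ?I j))"
    by (rule card_UN_le) simp
  also have "\<dots> \<le> (\<Sum>j<n. j div 2 + 1)"
  proof (rule sum_mono)
    fix j :: nat
    have "?I j \<subseteq> (\<lambda>k. j - 2 * k) ` {..j div 2}"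
    proof
      fix i assume "i \<in> ?I j"
      then have "i = j - 2 * ((j - i) div 2)" "(j - i) div 2 \<le> j div 2"
        by (auto simp: div_le_mono)
      then show "i \<in> (\<lambda>k. j - 2 * k) ` {..j div 2}" by blast
    qed
    then have "card (?I j) \<le> j div 2 + 1"
      using surj_card_le[of "{..j div 2}" "?I j" "\<lambda>k. j - 2 * k"] by simp
    moreover have "card ((\<lambda>i. {i, j}) ` ?I j) \<le> card (?I j)"
      by (rule card_image_le) simp
    ultimately show "card ((\<lambda>i. {i, j}) ` ?I j) \<le> j div 2 + 1" by linarith
  qed
  also have "\<dots> = (n + 1)\<^sup>2 div 4"
  proof (induction n)
    case (Suc n)
    have "(Suc n + 1)\<^sup>2 div 4 = (n + 1)\<^sup>2 div 4 + (n div 2 + 1)"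
    proof (cases "even n")
      case True
      then obtain k where "n = 2 * k" by auto
      then have "(n + 1)\<^sup>2 = 4 * (k * k + k) + 1" "(Suc n + 1)\<^sup>2 = 4 * (k * k + k + (k + 1))"
        "n div 2 = k"
        by (simp_all add: power2_eq_square algebra_simps)
      moreover have "4 * (t + (k + 1)) div 4 = (4 * t + 1) div 4 + (k + 1)" for t :: nat
        by presburger
      ultimately show ?thesis by metis
    next
      case False
      then obtain k where "n = 2 * k + 1" by (auto elim: oddE)
      then have "(n + 1)\<^sup>2 = 4 * ((k + 1) * (k + 1))"
        "(Suc n + 1)\<^sup>2 = 4 * ((k + 1) * (k + 1) + (k + 1)) + 1" "n div 2 = k"
        by (simp_all add: power2_eq_square algebra_simps)
      moreover have "(4 * (t + (k + 1)) + 1) div 4 = 4 * t div 4 + (k + 1)" for t :: nat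
        by presburger
      ultimately show ?thesis by metis
    qed
    then show ?case using Suc by simp
  qed simp
  finally show ?thesis .
qed

section \<open>The minimum\<close>

lemma floor_quarter_square:
  fixes n :: nat
  shows "\<lfloor>(real n + 1)\<^sup>2 / 4\<rfloor> = int ((n + 1)\<^sup>2 div 4)"
proof -
  have "(real n + 1)\<^sup>2 / 4 = real ((n + 1)\<^sup>2) / real 4" by simp
  then show ?thesis by (simp only: floor_divide_of_nat_eq)
qed

lemma floor_quarter_square_eq_floor_times_ceiling:
  fixes n :: nat
  shows "\<lfloor>(real n + 1)\<^sup>2 / 4\<rfloor> = \<lfloor>(real n + 1) / 2\<rfloor> * \<lceil>(real n + 1) / 2\<rceil>"
proof (cases "even n")
  case True
  then obtain k where k: "n = 2 * k" by auto
  have "\<lfloor>(real n + 1) / 2\<rfloor> = int k" "\<lceil>(real n + 1) / 2\<rceil> = int k + 1"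
    using k by (auto simp: floor_eq_iff ceiling_eq_iff field_simps)
  moreover have "(n + 1)\<^sup>2 = 4 * (k * (k + 1)) + 1"
    using k by (simp add: power2_eq_square algebra_simps)
  then have "(n + 1)\<^sup>2 div 4 = k * (k + 1)" by linarith
  ultimately show ?thesis unfolding floor_quarter_square by (simp add: algebra_simps)
next
  case False
  then obtain k where k: "n = 2 * k + 1" by (auto elim: oddE)
  then have "(real n + 1) / 2 = real (k + 1)" by simp
  then have "\<lfloor>(real n + 1) / 2\<rfloor> = int (k + 1)" "\<lceil>(real n + 1) / 2\<rceil> = int (k + 1)"
    by (simp_all only: floor_of_nat ceiling_of_nat)
  moreover have "(n + 1)\<^sup>2 = 4 * ((k + 1) * (k + 1))"
    using k by (simp add: power2_eq_square algebra_simps)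
  then have "(n + 1)\<^sup>2 div 4 = (k + 1) * (k + 1)" by linarith
  ultimately show ?thesis unfolding floor_quarter_square by (simp add: algebra_simps)
qed
lemma connected_graphsD:
  assumes "G \<in> connected_graphs n"
  shows "pverts G = {0..<n}" "parcs G \<subseteq> {0..<n} \<times> {0..<n}" "sym (parcs G)"
    "\<And>u v. u \<in> {0..<n} \<Longrightarrow> v \<in> {0..<n} \<Longrightarrow> (u, v) \<in> (parcs G)\<^sup>*"
proof -
  have V: "pverts G = {0..<n}" and con: "connected (with_proj G)" and "pair_graph G"
    using assms by (auto simp: connected_graphs_def)
  interpret pair_graph G by fact
  show "pverts G = {0..<n}" by fact
  show "parcs G \<subseteq> {0..<n} \<times> {0..<n}"
    using in_arcsD1 in_arcsD2 V by auto
  show "sym (parcs G)"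
    using pair_sym_arcs by (simp add: symmetric_def)
  fix u v assume "u \<in> {0..<n}" "v \<in> {0..<n}"
  then have "u \<rightarrow>\<^sup>*\<^bsub>with_proj G\<^esub> v"
    using symmetric_connected_imp_strongly_connected[OF pair_sym_arcs con] V
    by (auto simp: strongly_connected_def)
  then show "(u, v) \<in> (parcs G)\<^sup>*"
    by (auto dest: reachable_rtranclI)
qed

lemma finite_connected_graphs: "finite (connected_graphs n)"
proof (rule finite_subset)
  let ?V = "{0..<n}"
  show "connected_graphs n \<subseteq> (\<lambda>E. \<lparr>pverts = ?V, parcs = E\<rparr>) ` Pow (?V \<times> ?V)"
  proof
    fix G assume "G \<in> connected_graphs n"
    then have "G = \<lparr>pverts = ?V, parcs = parcs G\<rparr>" "parcs G \<in> Pow (?V \<times> ?V)"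
      using connected_graphsD(1,2)[of G n] by auto
    then show "G \<in> (\<lambda>E. \<lparr>pverts = ?V, parcs = E\<rparr>) ` Pow (?V \<times> ?V)"
      by (rule image_eqI)
  qed
qed simp

lemma double_star_connected_graph:
  assumes "n \<ge> 1"
  shows "\<lparr>pverts = {0..<n}, parcs = double_star n\<rparr> \<in> connected_graphs n"
proof -
  let ?G = "\<lparr>pverts = {0..<n}, parcs = double_star n\<rparr>"
  have sub: "double_star n \<subseteq> {0..<n} \<times> {0..<n}"
    by (auto simp: double_star_def)
  interpret pair_graph ?G
  proof
    show "finite (parcs ?G)"
      using sub by (auto intro: finite_subset)
    show "symmetric (with_proj ?G)"
      by (auto simp: symmetric_def sym_def double_star_def)
  qed (auto simp: double_star_def)
  have "u \<rightarrow>\<^sup>*\<^bsub>with_proj ?G\<^esub> v" if "u \<in> {0..<n}" "v \<in> {0..<n}" for u v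
  proof (cases "u = v")
    case True
    then show ?thesis using reachable_refl[of u] that by simp
  next
    case False
    then have "(u, v) \<in> (double_star n)\<^sup>+"
      using double_star_connected[of u n v] that by (auto simp: rtrancl_eq_or_trancl)
    then show ?thesis using reachable1_reachable[of u v] by simp
  qed
  then have "connected (with_proj ?G)"
    using assms reachable_mk_symmetric_eq[OF pair_sym_arcs]
    by (simp add: connected_def strongly_connected_def)
  then show ?thesis
    using pair_graph by (simp add: connected_graphs_def)
qed

lemma min_num_minimal_codewords_eq:
  assumes "n \<ge> 1"
  shows "min_num_minimal_codewords n = (n + 1)\<^sup>2 div 4"
proof -
  have lower: "(n + 1)\<^sup>2 div 4 \<le> num_minimal_codewords G" if G: "G \<in> connected_graphs n" for G
    using minimal_vertex_sets_ge[of "{0..<n}" "parcs G"] connected_graphsD[OF G]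
    by (simp add: num_minimal_codewords_eq)
  let ?G = "\<lparr>pverts = {0..<n}, parcs = double_star n\<rparr>"
  have G: "?G \<in> connected_graphs n"
    using assms by (rule double_star_connected_graph)
  have "num_minimal_codewords ?G \<le> (n + 1)\<^sup>2 div 4"
    using minimal_vertex_sets_double_star_le[of n]
      num_minimal_codewords_eq[OF connected_graphsD(1,2)[OF G]] by simp
  then have "num_minimal_codewords ?G = (n + 1)\<^sup>2 div 4"
    using lower[OF G] by (rule antisym)
  then show ?thesis
    unfolding min_num_minimal_codewords_def
    using G lower finite_connected_graphs by (intro Min_eqI) (auto intro: rev_image_eqI)
qed

theorem theorem4p1:
  fixes n :: nat
  assumes "n \<ge> 1"
  shows "int (min_num_minimal_codewords n) = \<lfloor>(real n + 1)\<^sup>2 / 4\<rfloor> \<and>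
         \<lfloor>(real n + 1)\<^sup>2 / 4\<rfloor> = \<lfloor>(real n + 1) / 2\<rfloor> * \<lceil>(real n + 1) / 2\<rceil>"
  using min_num_minimal_codewords_eq[OF assms] floor_quarter_square[of n]
    floor_quarter_square_eq_floor_times_ceiling[of n] by simp

end
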